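(* Suppose that $P(G_i=1)\in(0,1)$. Then, for a given $\omega_i$, $$\mathrm{DiD}-\mathrm{ATT}=\Delta^{\mathrm{sel}}_{\mathrm{post}}+\Delta^{\mathrm{dev}}_{\mathrm{post}},$$ where $$\Delta^{\mathrm{sel}}_{\mathrm{post}}=\frac{E\big[(G_i-E[G_i\mid\omega_i])(\dot Y_{i2}(0)-\dot Y_{i1}(0))\big]}{P(G_i=1)P(G_i=0)},\qquad \Delta^{\mathrm{dev}}_{\mathrm{post}}=\frac{E\big[E[G_i\mid\omega_i]\,E[\dot Y_{i2}(0)-\dot Y_{i1}(0)\mid\omega_i]\big]}{P(G_i=1)P(G_i=0)}.$$
   Context: For a generic unit $i$, $G_i\in\{0,1\}$ is the treatment-group indicator: units with $G_i=1$ are untreated in periods before $t=2$ and treated at $t=2$; units with $G_i=0$ are never treated. $Y_{it}(1),Y_{it}(0)$ are real-valued potential outcomes with and without treatment, and (no anticipation) the observed outcomes are $Y_{it}=Y_{it}(0)$ for $t<2$ and $Y_{i2}=G_iY_{i2}(1)+(1-G_i)Y_{i2}(0)$. All relevant moments exist (in particular $Y_{i1}(0),Y_{i2}(0),Y_{i2}(1)$ are integrable). Define $\mathrm{DiD}=E[Y_{i2}-Y_{i1}\mid G_i=1]-E[Y_{i2}-Y_{i1}\mid G_i=0]$, $\mathrm{ATT}=E[Y_{i2}(1)-Y_{i2}(0)\mid G_i=1]$, and $\dot Y_{it}(0)=Y_{it}(0)-E[Y_{it}(0)]$. There is an additional pre-treatment period $t=0$; $\omega_i$ is any (measurable) function or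 subvector of the unobservable random vectors $(\alpha_i,\varepsilon_{i0},\varepsilon_{i1},\varepsilon_{i2},\mu_i,\eta_{i0},\eta_{i1},\eta_{i2})$, where $Y_{it}(0)=\xi_t(\alpha_i,\varepsilon_{it})$ for arbitrary functions $\xi_t$. No restriction is placed on how $G_i$ depends on the unobservables. *)

theory Defs
  imports "HOL-Probability.Probability"
begin

definition cond_expectation_event :: "'o measure \<Rightarrow> 'o set \<Rightarrow> ('o \<Rightarrow> real) \<Rightarrow> real" where
  "cond_expectation_event M A X = (LINT x|uniform_measure M A. X x)"

text \<open>
  The conditional expectation of \<open>X\<close> given a random element \<open>\<omega>\<close> with values in \<open>N\<close> is
  conditional expectation given the sigma-algebra generated by \<open>\<omega>\<close>; as always in the library,
  it is a version, determined up to a null set.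
\<close>

definition cond_expectation_rv ::
  "'o measure \<Rightarrow> 'w measure \<Rightarrow> ('o \<Rightarrow> 'w) \<Rightarrow> ('o \<Rightarrow> real) \<Rightarrow> 'o \<Rightarrow> real" where
  "cond_expectation_rv M N \<omega> X = real_cond_exp M (vimage_algebra (space M) \<omega> N) X"

text \<open>
  Points of the sample space play the role of the generic unit. Below, \<open>Y\<close>, \<open>Y0\<close> and \<open>Y1\<close> are
  the observed, untreated and treated outcomes, indexed by the period.
\<close>

definition DiD :: "'o measure \<Rightarrow> ('o \<Rightarrow> real) \<Rightarrow> (nat \<Rightarrow> 'o \<Rightarrow> real) \<Rightarrow> real" where
  "DiD M G Y =
     cond_expectation_event M {x \<in> space M. G x = 1} (\<lambda>x. Y 2 x - Y 1 x)
   - cond_expectation_event M {x \<in> space M. G x = 0} (\<lambda>x. Y 2 x - Y 1 x)"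

definition ATT ::
  "'o measure \<Rightarrow> ('o \<Rightarrow> real) \<Rightarrow> (nat \<Rightarrow> 'o \<Rightarrow> real) \<Rightarrow> (nat \<Rightarrow> 'o \<Rightarrow> real) \<Rightarrow> real" where
  "ATT M G Y0 Y1 =
     cond_expectation_event M {x \<in> space M. G x = 1} (\<lambda>x. Y1 2 x - Y0 2 x)"

definition demeaned :: "'o measure \<Rightarrow> (nat \<Rightarrow> 'o \<Rightarrow> real) \<Rightarrow> nat \<Rightarrow> 'o \<Rightarrow> real" where
  "demeaned M Y0 t x = Y0 t x - (LINT z|M. Y0 t z)"

definition Delta_sel_post ::
  "'o measure \<Rightarrow> 'w measure \<Rightarrow> ('o \<Rightarrow> 'w) \<Rightarrow> ('o \<Rightarrow> real) \<Rightarrow> (nat \<Rightarrow> 'o \<Rightarrow> real) \<Rightarrow> real" where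
  "Delta_sel_post M N \<omega> G Y0 =
     (LINT x|M. (G x - cond_expectation_rv M N \<omega> G x)
                * (demeaned M Y0 2 x - demeaned M Y0 1 x))
     / (\<P>(x in M. G x = 1) * \<P>(x in M. G x = 0))"

definition Delta_dev_post ::
  "'o measure \<Rightarrow> 'w measure \<Rightarrow> ('o \<Rightarrow> 'w) \<Rightarrow> ('o \<Rightarrow> real) \<Rightarrow> (nat \<Rightarrow> 'o \<Rightarrow> real) \<Rightarrow> real" where
  "Delta_dev_post M N \<omega> G Y0 =
     (LINT x|M. cond_expectation_rv M N \<omega> G x
                * cond_expectation_rv M N \<omega>
                    (\<lambda>z. demeaned M Y0 2 z - demeaned M Y0 1 z) x)
     / (\<P>(x in M. G x = 1) * \<P>(x in M. G x = 0))"

end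

theory Submission
  imports Defs
begin

text \<open>
  DiD minus ATT is the covariance of \<open>G\<close> with the untreated trend \<open>Y0 2 - Y0 1\<close>, normalized by
  \<open>P(G = 1) P(G = 0)\<close>; hence it is \<open>E[G D]\<close> with the same normalization, where \<open>D\<close> is the demeaned
  trend. Splitting \<open>G\<close> into \<open>G - E[G | \<omega>]\<close> and \<open>E[G | \<omega>]\<close> gives the two terms: as \<open>E[G | \<omega>]\<close> is
  bounded and \<open>\<omega>\<close>-measurable, \<open>D\<close> may be replaced by \<open>E[D | \<omega>]\<close> in the second one.
\<close>

text \<open>For a null \<open>A\<close> both sides are 0: the uniform measure is then the zero
  measure, and division by 0 gives 0. Otherwise the density
  \<open>indicator A x / measure M A\<close> can be written as a real quotient and integrated
  against.\<close>

lemma (in finite_measure) cond_expectation_event_eq: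
  assumes A: "A \<in> sets M" and f: "f \<in> borel_measurable M"
  shows "cond_expectation_event M A f = (LINT x|M. indicator A x * f x) / measure M A"
proof (cases "measure M A = 0")
  case True
  then have "AE x in M. x \<notin> A"
    using A by (intro AE_not_in null_setsI) (simp_all add: emeasure_eq_measure)
  then have "AE x in uniform_measure M A. f x = 0"
    unfolding uniform_measure_def using A by (auto simp: AE_density indicator_def)
  then have "(LINT x|uniform_measure M A. f x) = 0"
    by (rule integral_eq_zero_AE)
  then show ?thesis
    using True by (simp add: cond_expectation_event_def)
next
  case False
  then have "measure M A > 0"
    by (simp add: zero_less_measure_iff)
  then have "uniform_measure M A = density M (\<lambda>x. ennreal (indicator A x / measure M A))"
    unfolding uniform_measure_def emeasure_eq_measure
    using A by (intro density_cong) (auto simp: divide_ennreal[symmetric] split: split_indicator)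
  then have "cond_expectation_event M A f = (LINT x|M. (indicator A x / measure M A) * f x)"
    unfolding cond_expectation_event_def using A f by (simp add: integral_density)
  then show ?thesis
    by simp
qed

lemma subalgebra_vimage_algebra:
  assumes "f \<in> M \<rightarrow>\<^sub>M N"
  shows "subalgebra M (vimage_algebra (space M) f N)"
  unfolding subalgebra_def using assms by (simp add: sets_image_in_sets)

lemma (in finite_measure_subalgebra) integral_mult_cond_exp_split:
  assumes D: "integrable M D" and G: "G \<in> borel_measurable M"
    and G01: "\<And>x. x \<in> space M \<Longrightarrow> 0 \<le> G x \<and> G x \<le> 1"
  shows "(LINT x|M. (G x - real_cond_exp M F G x) * D x)
           + (LINT x|M. real_cond_exp M F G x * real_cond_exp M F D x)
         = (LINT x|M. G x * D x)"
proof -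
  let ?P = "real_cond_exp M F G"
  have GI: "integrable M G"
    using G G01 by (intro integrable_const_bound[where B = 1]) auto
  \<comment> \<open>A conditional expectation is only a version, so it inherits the bounds of
    \<open>G\<close> almost everywhere; \<open>bound\<close> is therefore stated with AE hypotheses,
    to cover both \<open>G\<close> and \<open>?P\<close>.\<close>
  have P: "AE x in M. 0 \<le> ?P x" "AE x in M. ?P x \<le> 1"
    using GI G01 by (auto intro!: real_cond_exp_ge_c real_cond_exp_le_c)
  have bound: "integrable M (\<lambda>x. H x * D x)"
    if "H \<in> borel_measurable M" "AE x in M. 0 \<le> H x" "AE x in M. H x \<le> 1" for H
  proof (rule Bochner_Integration.integrable_bound[OF D])
    show "(\<lambda>x. H x * D x) \<in> borel_measurable M"
      using that D by measurable
    show "AE x in M. norm (H x * D x) \<le> norm (D x)"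
      using that(2,3) by eventually_elim (simp add: abs_mult mult_left_le_one_le)
  qed
  have "integrable M (\<lambda>x. ?P x * D x)"
    using P by (intro bound) auto
  moreover have "integrable M (\<lambda>x. G x * D x)"
    using G G01 by (intro bound) auto
  \<comment> \<open>Pull-out property: \<open>?P\<close> is \<open>F\<close>-measurable, and
    \<open>?P x * D x\<close> is integrable by \<open>bound\<close>.\<close>
  moreover have "(LINT x|M. ?P x * real_cond_exp M F D x) = (LINT x|M. ?P x * D x)"
    using D calculation(1) by (intro real_cond_exp_intg) auto
  ultimately show ?thesis
    by (simp add: left_diff_distrib)
qed

theorem lemma4p1:
  fixes M :: "'o measure"
    and G :: "'o \<Rightarrow> real"
    and Y Y0 Y1 :: "nat \<Rightarrow> 'o \<Rightarrow> real"
    and \<alpha> :: "'o \<Rightarrow> 'a::euclidean_space"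
    and \<epsilon> :: "nat \<Rightarrow> 'o \<Rightarrow> 'e::euclidean_space"
    and \<mu> :: "'o \<Rightarrow> 'm::euclidean_space"
    and \<eta> :: "nat \<Rightarrow> 'o \<Rightarrow> 'h::euclidean_space"
    and \<xi> :: "nat \<Rightarrow> 'a \<times> 'e \<Rightarrow> real"
    and N :: "'w measure"
    and w :: "'a \<times> 'e \<times> 'e \<times> 'e \<times> 'm \<times> 'h \<times> 'h \<times> 'h \<Rightarrow> 'w"
    and \<omega> :: "'o \<Rightarrow> 'w"
  assumes "prob_space M"
    and "G \<in> borel_measurable M"
    and "\<And>x. x \<in> space M \<Longrightarrow> G x \<in> {0, 1}"
    and "\<alpha> \<in> borel_measurable M"
    and "\<And>t. t \<in> {0, 1, 2} \<Longrightarrow> \<epsilon> t \<in> borel_measurable M"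
    and "\<mu> \<in> borel_measurable M"
    and "\<And>t. t \<in> {0, 1, 2} \<Longrightarrow> \<eta> t \<in> borel_measurable M"
    and "\<And>t x. t \<in> {0, 1, 2} \<Longrightarrow> x \<in> space M \<Longrightarrow> Y0 t x = \<xi> t (\<alpha> x, \<epsilon> t x)"
    and "integrable M (Y0 1)"
    and "integrable M (Y0 2)"
    and "integrable M (Y1 2)"
    and "\<And>t x. t < 2 \<Longrightarrow> x \<in> space M \<Longrightarrow> Y t x = Y0 t x"
    and "\<And>x. x \<in> space M \<Longrightarrow> Y 2 x = G x * Y1 2 x + (1 - G x) * Y0 2 x"
    and "w \<in> borel \<rightarrow>\<^sub>M N"
    and "\<And>x. x \<in> space M \<Longrightarrow>
           \<omega> x = w (\<alpha> x, \<epsilon> 0 x, \<epsilon> 1 x, \<epsilon> 2 x, \<mu> x, \<eta> 0 x, \<eta> 1 x, \<eta> 2 x)"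
    and "\<P>(x in M. G x = 1) \<in> {0<..<1}"
  shows "DiD M G Y - ATT M G Y0 Y1 = Delta_sel_post M N \<omega> G Y0 + Delta_dev_post M N \<omega> G Y0"
proof -
  interpret prob_space M by fact
  note [measurable] = assms(2,4,6)
  have [measurable]: "\<epsilon> 0 \<in> borel_measurable M" "\<epsilon> 1 \<in> borel_measurable M" "\<epsilon> 2 \<in> borel_measurable M"
    "\<eta> 0 \<in> borel_measurable M" "\<eta> 1 \<in> borel_measurable M" "\<eta> 2 \<in> borel_measurable M"
    using assms(5,7) by auto
  have [measurable]: "Y0 1 \<in> borel_measurable M" "Y0 2 \<in> borel_measurable M"
      "Y1 2 \<in> borel_measurable M"
    using assms(9-11) by auto
  \<comment> \<open>Measurability of \<omega> makes its generated sigma-algebra a subalgebra of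
    \<open>M\<close>. Since \<omega> agrees with this composition only on \<open>space M\<close>, it
    is obtained by congruence.\<close>
  have "(\<lambda>x. w (\<alpha> x, \<epsilon> 0 x, \<epsilon> 1 x, \<epsilon> 2 x, \<mu> x, \<eta> 0 x, \<eta> 1 x, \<eta> 2 x)) \<in> M \<rightarrow>\<^sub>M N"
    by (intro measurable_compose[OF _ assms(14)] borel_measurable_Pair) measurable
  then have "\<omega> \<in> M \<rightarrow>\<^sub>M N"
    using assms(15) by (simp cong: measurable_cong)
  then interpret finite_measure_subalgebra M "vimage_algebra (space M) \<omega> N"
    by unfold_locales (rule subalgebra_vimage_algebra)

  \<comment> \<open>Both sides of the claim will be reduced to
    \<open>(c - p * m) / (p * (1 - p))\<close>, whose numerator is the covariance of
    \<open>G\<close> and \<open>d\<close>.\<close>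
  define p where "p = \<P>(x in M. G x = 1)"
  define d where "d x = Y0 2 x - Y0 1 x" for x
  define m where "m = (LINT x|M. d x)"
  define c where "c = (LINT x|M. G x * d x)"
  define D where "D x = demeaned M Y0 2 x - demeaned M Y0 1 x" for x
  let ?A = "{x \<in> space M. G x = 1}" and ?B = "{x \<in> space M. G x = 0}"
  have p: "0 < p" "p < 1"
    using assms(16) by (auto simp: p_def)
  have q: "\<P>(x in M. G x = 0) = 1 - p"
  proof -
    have "?B = space M - ?A"
      using assms(3) by auto
    then show ?thesis
      unfolding p_def by (simp add: prob_compl)
  qed
  have bound: "integrable M (\<lambda>x. G x * h x)" if "integrable M h" for h
  proof (rule Bochner_Integration.integrable_bound[OF that])
    show "AE x in M. norm (G x * h x) \<le> norm (h x)"
      using assms(3) by (intro AE_I2) fastforce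
  qed (use that in measurable)
  have d: "integrable M d"
    unfolding d_def using assms(9,10) by simp
  have D: "D = (\<lambda>x. d x - m)"
    using assms(9,10) by (auto simp: D_def d_def m_def demeaned_def)
  have intG: "(LINT x|M. G x) = p"
  proof -
    have "(LINT x|M. G x) = (LINT x|M. indicator ?A x)"
      using assms(3) by (intro Bochner_Integration.integral_cong) (auto simp: indicator_def)
    then show ?thesis
      by (simp add: p_def)
  qed
  \<comment> \<open>The instance of \<open>bound\<close> at the constant 1 is integrability of
    \<open>G\<close> itself.\<close>
  have GD: "(LINT x|M. G x * D x) = c - p * m"
    using bound[OF d] bound[of "\<lambda>_. 1"] by (simp add: D right_diff_distrib c_def intG)

  \<comment> \<open>Measurability of the observed change is inherited from the potential outcomes,
    through the formulas for \<open>Y\<close> on \<open>space M\<close>.\<close>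
  have Ymeas: "(\<lambda>x. Y 2 x - Y 1 x) \<in> borel_measurable M"
  proof (subst measurable_cong)
    show "Y 2 x - Y 1 x = G x * Y1 2 x + (1 - G x) * Y0 2 x - Y0 1 x" if "x \<in> space M" for x
      using that assms(12,13) by simp
  qed measurable
  have "cond_expectation_event M ?A (\<lambda>x. Y 2 x - Y 1 x)
      = (LINT x|M. G x * (Y1 2 x - Y0 2 x) + G x * d x) / p"
  proof -
    \<comment> \<open>For the treated, the indicator is \<open>G\<close> and the observed change is
      the treatment effect plus the untreated trend.\<close>
    have "indicator ?A x * (Y 2 x - Y 1 x) = G x * (Y1 2 x - Y0 2 x) + G x * d x"
      if "x \<in> space M" for x
      using that assms(3)[of x] assms(12)[of 1 x] assms(13)[of x] by (auto simp: d_def)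
    then have "(LINT x|M. indicator ?A x * (Y 2 x - Y 1 x))
        = (LINT x|M. G x * (Y1 2 x - Y0 2 x) + G x * d x)"
      by (intro Bochner_Integration.integral_cong) auto
    then show ?thesis
      using Ymeas by (subst cond_expectation_event_eq) (simp_all add: p_def)
  qed
  moreover have "cond_expectation_event M ?B (\<lambda>x. Y 2 x - Y 1 x)
      = (LINT x|M. d x - G x * d x) / (1 - p)"
  proof -
    \<comment> \<open>For the untreated, the indicator is \<open>1 - G\<close> and the observed
      change is the untreated trend.\<close>
    have "indicator ?B x * (Y 2 x - Y 1 x) = d x - G x * d x" if "x \<in> space M" for x
      using that assms(3)[of x] assms(12)[of 1 x] assms(13)[of x] by (auto simp: d_def)
    then have "(LINT x|M. indicator ?B x * (Y 2 x - Y 1 x)) = (LINT x|M. d x - G x * d x)"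
      by (intro Bochner_Integration.integral_cong) auto
    then show ?thesis
      using Ymeas by (subst cond_expectation_event_eq) (simp_all add: q)
  qed
  moreover have "ATT M G Y0 Y1 = (LINT x|M. G x * (Y1 2 x - Y0 2 x)) / p"
  proof -
    have "indicator ?A x * (Y1 2 x - Y0 2 x) = G x * (Y1 2 x - Y0 2 x)" if "x \<in> space M" for x
      using that assms(3)[of x] by auto
    then have "(LINT x|M. indicator ?A x * (Y1 2 x - Y0 2 x))
        = (LINT x|M. G x * (Y1 2 x - Y0 2 x))"
      by (intro Bochner_Integration.integral_cong) auto
    then show ?thesis
      unfolding ATT_def by (subst cond_expectation_event_eq) (simp_all add: p_def)
  qed
  \<comment> \<open>The treatment-effect integral over the treated is exactly ATT and cancels;
    splitting it off uses integrability of both summands.\<close>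
  ultimately have "DiD M G Y - ATT M G Y0 Y1 = c / p - (m - c) / (1 - p)"
    using bound[OF d] bound[of "\<lambda>x. Y1 2 x - Y0 2 x"] d assms(10,11)
    by (simp add: DiD_def c_def m_def add_divide_distrib)
  also have "\<dots> = (c - p * m) / (p * (1 - p))"
    using p by (simp add: field_simps)
  also have "\<dots> = Delta_sel_post M N \<omega> G Y0 + Delta_dev_post M N \<omega> G Y0"
  proof -
    have "integrable M D"
      unfolding D using d by simp
    moreover have "0 \<le> G x \<and> G x \<le> 1" if "x \<in> space M" for x
      using assms(3)[OF that] by auto
    ultimately have "(LINT x|M. (G x - cond_expectation_rv M N \<omega> G x) * D x)
        + (LINT x|M. cond_expectation_rv M N \<omega> G x * cond_expectation_rv M N \<omega> D x)
        = c - p * m"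
      unfolding cond_expectation_rv_def GD[symmetric]
      by (rule integral_mult_cond_exp_split[OF _ assms(2)])
    then show ?thesis
      unfolding Delta_sel_post_def Delta_dev_post_def q p_def[symmetric] D_def[symmetric]
      unfolding add_divide_distrib[symmetric] by (rule arg_cong[OF sym])
  qed
  finally show ?thesis .
qed

end
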